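(* Let $t \geq k \geq 3$ be integers and let $\mathcal{H}$ be a nonempty $k$-uniform hypergraph with degree bound $d$ satisfying $$\binom{t+1}{k-1} - \frac{k-2}{k-1}(t-k+3) \leq d < \binom{t+1}{k-1}.$$ Then $$\frac{|\sigma(\mathcal{H})|}{|\mathcal{H}|} \geq \frac{k\binom{t+1}{k-2}}{(k-1)d} = \frac{\binom{t+2}{k-1}}{\binom{t+2}{k} - \frac{t+2}{k}\left(\binom{t+1}{k-1} - d\right)}.$$
   Context: A $k$-uniform hypergraph on $[n]=\{1,\ldots,n\}$ ($n$ a positive integer) is a family $\mathcal{H} \subset \binom{[n]}{k}$ of $k$-element subsets of $[n]$, called hyperedges; $|\mathcal{H}|$ is the number of hyperedges. The shadow of $\mathcal{H}$ is $\sigma(\mathcal{H}) = \{S \in \binom{[n]}{k-1} : \exists H \in \mathcal{H},\ S \subset H\}$. The maximum degree is $\Delta(\mathcal{H}) = \max_{v \in [n]} |\{H \in \mathcal{H} : v \in H\}|$, and a degree bound of $\mathcal{H}$ is any real number $d$ with $\Delta(\mathcal{H}) \leq d$. *)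

theory Defs
  imports Complex_Main "HOL-Library.Ramsey"
begin

text \<open>The library term \<open>nsets A k\<close> is the family of all \<open>k\<close>-element subsets of \<open>A\<close>.\<close>

definition uniform_hypergraph :: "nat \<Rightarrow> nat \<Rightarrow> nat set set \<Rightarrow> bool" where
  "uniform_hypergraph n k H \<longleftrightarrow> n \<ge> 1 \<and> H \<subseteq> nsets {1..n} k"

definition shadow :: "nat \<Rightarrow> nat \<Rightarrow> nat set set \<Rightarrow> nat set set" where
  "shadow n k H = {S \<in> nsets {1..n} (k - 1). \<exists>E\<in>H. S \<subseteq> E}"

definition max_degree :: "nat \<Rightarrow> nat set set \<Rightarrow> nat" where
  "max_degree n H = Max ((\<lambda>v. card {E \<in> H. v \<in> E}) ` {1..n})"

definition degree_bound :: "nat \<Rightarrow> nat set set \<Rightarrow> real \<Rightarrow> bool" where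
  "degree_bound n H d \<longleftrightarrow> real (max_degree n H) \<le> d"

end

theory Submission
  imports Defs
begin

text \<open>
  Every hyperedge through a vertex v becomes, after deletion of v, an edge of the link of v; the
  links are (k-1)-uniform and have at most d edges. Counting incidences, the sizes of the links add
  up to k times the number of hyperedges, and the sizes of their shadows add up to at most k-1
  times the size of the shadow (\<open>shadow_ratio_from_links\<close>). So it is enough that a link with
  m \<le> d edges has a shadow of size at least m C / d. Here r = k-1, N = t+1 = r+b, C is the
  binomial coefficient of N over r-1, T is that of N over r, and a = b+1 = N-r+1 is the number of
  r-subsets of [N] that contain a given (r-1)-subset.

  The shadow of m sets is at least as large as the value at m of the cascade function of the
  Kruskal-Katona theorem (\<open>kruskal_katona\<close>), which is proved here by Frankl's shifting
  argument. The rest is arithmetic of that function. If m > T - a, then fewer than a of the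
  r-subsets of [N] are missing, too few to take away all extensions of an (r-1)-set; the shadow
  keeps its size C, which settles this case since m \<le> d (\<open>cascade_shadow_near_top\<close>).
  If m \<le> T - a, then shadow size over m is at least (C-1)/(T-a), the value for the family of all
  r-subsets of [N] that do not contain one fixed (r-1)-set (\<open>cascade_shadow_below_top\<close>). The lower bound imposed on d,
  namely d \<ge> T - a(r-1)/r, makes (C-1)/(T-a) \<ge> C/d, because r T = a C
  (\<open>cascade_shadow_ge_linear\<close>).

  The Lovasz form of the Kruskal-Katona theorem would not do instead of exact cascades: for r \<ge> 3,
  large N and the smallest admissible d it is too weak at m = T - a.
\<close>

section \<open>Two lower bounds for binomial coefficients\<close>

text \<open>
  The right-hand side counts all i-subsets of an n-set; the left-hand side counts those that arise
  from a fixed one by exchanging at most one element.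
\<close>

lemma one_plus_mult_le_binomial:
  "i \<le> n \<Longrightarrow> 1 + i * (n - i) \<le> n choose i"
proof (induction n arbitrary: i)
  case 0
  then show ?case by simp
next
  case (Suc n)
  show ?case
  proof (cases i)
    case 0
    then show ?thesis by simp
  next
    case (Suc j)
    with Suc.prems have "j \<le> n" by simp
    show ?thesis
    proof (cases "j = n")
      case True
      then show ?thesis using \<open>i = Suc j\<close> by simp
    next
      case False
      with \<open>j \<le> n\<close> obtain c where c: "n = j + Suc c"
        by (metis le_neq_implies_less less_imp_Suc_add add_Suc_right)
      have "1 + j * Suc c \<le> n choose j" "1 + Suc j * c \<le> n choose Suc j"
        using Suc.IH[of j] Suc.IH[of "Suc j"] c by (simp_all del: binomial_Suc_Suc)
      then have "1 + Suc j * Suc c \<le> (n choose j) + (n choose Suc j)"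
        by simp
      then show ?thesis
        using \<open>i = Suc j\<close> c by simp
    qed
  qed
qed

text \<open>
  For n = j+3 the binomial coefficient is (j+3)(j+2)(j+1)/6, and (j+3)(j+2) - 6(j+1) = j(j-1) is
  nonnegative for every natural j.
\<close>

lemma square_le_binomial:
  assumes "j + 3 \<le> n"
  shows "(j + 1)\<^sup>2 \<le> n choose j"
proof -
  have "2 * ((j + 2) choose 2) = (j + 2) * (j + 1)"
    using Suc_times_binomial[of 1 "j + 1"] by (simp add: numeral_2_eq_2)
  moreover have "3 * ((j + 3) choose 3) = (j + 3) * ((j + 2) choose 2)"
    using Suc_times_binomial[of 2 "j + 2"] by (simp add: numeral_3_eq_3)
  ultimately have "2 * (3 * ((j + 3) choose 3)) = (j + 3) * ((j + 2) * (j + 1))"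
    by (metis mult.left_commute)
  then have "6 * ((j + 3) choose 3) = (j + 3) * (j + 2) * (j + 1)"
    by (simp only: mult.assoc[symmetric] numeral_times_numeral arith_simps semiring_norm)
  moreover have "6 * (j + 1) \<le> (j + 3) * (j + 2)"
    by (cases j) (simp_all add: algebra_simps)
  then have "6 * (j + 1) * (j + 1) \<le> (j + 3) * (j + 2) * (j + 1)"
    by (rule mult_le_mono1)
  ultimately have "6 * ((j + 1) * (j + 1)) \<le> 6 * ((j + 3) choose 3)"
    by (simp only: mult.assoc)
  then have "(j + 1)\<^sup>2 \<le> (j + 3) choose 3"
    by (simp only: power2_eq_square nat_mult_le_cancel_disj)
  also have "(j + 3) choose 3 = (j + 3) choose j"
    using binomial_symmetric[of 3 "j + 3"] by simp
  also have "\<dots> \<le> n choose j"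
    using assms by (rule binomial_right_mono)
  finally show ?thesis .
qed

section \<open>The cascade function\<close>

text \<open>
  Writing m greedily as (n over r) + (n' over r-1) + ... with n > n' > ..., the function lowers
  every lower index by one. This is the number of sets in the shadow of the first m sets of size r
  in the colexicographic order. The value 0 in uniformity 0 reflects that the empty set has
  no shadow.
\<close>

primrec cascade_shadow :: "nat \<Rightarrow> nat \<Rightarrow> nat" where
  "cascade_shadow 0 m = 0"
| "cascade_shadow (Suc r) m =
     (if m = 0 then 0
      else let n = GREATEST n. n choose Suc r \<le> m
           in (n choose r) + cascade_shadow r (m - (n choose Suc r)))"

lemma cascade_shadow_zero [simp]: "cascade_shadow r 0 = 0"
  by (cases r) simp_all

lemma cascade_shadow_step_strict:
  assumes "r < n" and "m < n choose r"
  shows "cascade_shadow (Suc r) ((n choose Suc r) + m) = (n choose r) + cascade_shadow r m"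
proof -
  have "(GREATEST n'. n' choose Suc r \<le> (n choose Suc r) + m) = n"
  proof (rule Greatest_equality)
    fix y assume y: "y choose Suc r \<le> (n choose Suc r) + m"
    show "y \<le> n"
    proof (rule ccontr)
      assume "\<not> y \<le> n"
      then have "Suc n choose Suc r \<le> y choose Suc r"
        by (intro binomial_right_mono) simp
      with y assms(2) show False by simp
    qed
  qed simp
  moreover have "n choose Suc r \<noteq> 0"
    using assms(1) by simp
  ultimately show ?thesis
    by simp
qed

declare cascade_shadow.simps(2) [simp del]

lemma cascade_shadow_binomial:
  assumes "r < n"
  shows "cascade_shadow (Suc r) (n choose Suc r) = n choose r"
  using cascade_shadow_step_strict[OF assms, of 0] assms by simp

text \<open>
  The recursion also holds for m = (n over r), although the greedy expansion is then a different one: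
  by Pascal's rule both sides are (n+1 over r). Admitting this endpoint spares later arguments a carry.
\<close>

lemma cascade_shadow_step:
  assumes "r < n" and "m \<le> n choose r"
  shows "cascade_shadow (Suc r) ((n choose Suc r) + m) = (n choose r) + cascade_shadow r m"
proof (cases "m < n choose r")
  case True
  with assms(1) show ?thesis by (rule cascade_shadow_step_strict)
next
  case False
  then have m: "m = n choose r" using assms(2) by simp
  have "cascade_shadow (Suc r) ((n choose Suc r) + m) = cascade_shadow (Suc r) (Suc n choose Suc r)"
    using m by (simp add: add.commute)
  also have "\<dots> = Suc n choose r"
    using assms(1) by (intro cascade_shadow_binomial) simp
  also have "\<dots> = (n choose r) + cascade_shadow r m"
  proof (cases r)
    case (Suc s)
    then show ?thesis using m assms(1) cascade_shadow_binomial[of s n] by simp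
  qed simp
  finally show ?thesis .
qed

lemma cascade_exists:
  assumes "0 < m"
  obtains n m' where "r < n" "m = (n choose Suc r) + m'" "m' < n choose r"
proof -
  have "m < (m + Suc r) choose Suc r"
    using one_plus_mult_le_binomial[of "Suc r" "m + Suc r"] by simp
  then obtain y where y: "m < y choose Suc r" "\<And>z. z < y \<Longrightarrow> \<not> m < z choose Suc r"
    using exists_least_iff[of "\<lambda>y. m < y choose Suc r"] by blast
  have "Suc r < y"
  proof (rule ccontr)
    assume "\<not> Suc r < y"
    then have "y choose Suc r \<le> Suc r choose Suc r"
      by (intro binomial_right_mono) simp
    with y(1) assms show False by simp
  qed
  then obtain n where n: "y = Suc n" "r < n"
    by (cases y) auto
  have "n choose Suc r \<le> m"
    using y(2)[of n] n by simp
  then show ?thesis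
    using that[of n "m - (n choose Suc r)"] y(1) n by auto
qed

lemma cascade_shadow_mono: "m \<le> m' \<Longrightarrow> cascade_shadow r m \<le> cascade_shadow r m'"
proof (induction r arbitrary: m m')
  case 0
  then show ?case by simp
next
  case (Suc r)
  have "cascade_shadow (Suc r) q \<le> cascade_shadow (Suc r) (Suc q)" for q
  proof (cases "q = 0")
    case False
    then obtain n q' where q': "r < n" "q = (n choose Suc r) + q'" "q' < n choose r"
      using cascade_exists[of q r] by auto
    have "cascade_shadow (Suc r) q = (n choose r) + cascade_shadow r q'"
      using q' by (simp only: cascade_shadow_step)
    moreover have "cascade_shadow (Suc r) (Suc q) = (n choose r) + cascade_shadow r (Suc q')"
      using cascade_shadow_step[of r n "Suc q'"] q' by simp
    ultimately show ?thesis using Suc.IH[of q' "Suc q'"] by simp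
  qed simp
  then show ?case
    using Suc.prems by (rule lift_Suc_mono_le)
qed

lemma cascade_shadow_pos:
  assumes "0 < m"
  shows "0 < cascade_shadow (Suc r) m"
proof -
  obtain n m' where "r < n" "m = (n choose Suc r) + m'" "m' < n choose r"
    using cascade_exists[OF assms, of r] .
  then show ?thesis by (simp add: cascade_shadow_step)
qed

lemma cascade_shadow_one: "cascade_shadow r (Suc 0) = r"
  using cascade_shadow_binomial[of "r - 1" r] by (cases r) auto

lemma cascade_shadow_Suc_0: "0 < m \<Longrightarrow> cascade_shadow (Suc 0) m = 1"
  using cascade_shadow_binomial[of 0 m] by simp

text \<open>
  The numerical core of the Kruskal-Katona theorem. Think of p as the number of sets that contain a
  fixed vertex and of q as the number of the others; if the latter have their shadow inside the link
  of the vertex, then q can be bounded through p as in the premise, and the conclusion is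
  the bound for all p+q sets. Both numbers are expanded by one step. Either they share the leading
  index n, and Pascal's rule reduces the claim to the remainders in the next lower uniformity; or q
  is at most the leading term that would fit p, and by monotonicity q may be raised to this term,
  which leaves the instance q = 0 for the remainder of p.
\<close>

lemma cascade_shadow_split:
  "cascade_shadow (Suc r) q \<le> p \<Longrightarrow> cascade_shadow (Suc r) (p + q) \<le> p + cascade_shadow r p"
proof (induction r arbitrary: p q)
  case 0
  show ?case
  proof (cases "p = 0")
    case True
    with 0 show ?thesis by simp
  next
    case False
    then show ?thesis by (simp add: cascade_shadow_Suc_0)
  qed
next
  case (Suc r)
  show ?case
  proof (cases "p = 0")
    case True
    with Suc.prems cascade_shadow_pos[of q "Suc r"] show ?thesis
      by (cases "q = 0") auto
  next
    case False
    then obtain n p' where p: "r < n" "p = (n choose Suc r) + p'" "p' < n choose r"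
      using cascade_exists[of p r] by auto
    have kkp: "cascade_shadow (Suc r) p = (n choose r) + cascade_shadow r p'"
      using p by (simp only: cascade_shadow_step)
    have p'_le: "p' \<le> Suc n choose Suc r"
      using p by simp
    show ?thesis
    (* If q exceeds the term with index n, then n is forced to be its leading index as well. *)
    proof (cases "q \<le> n choose Suc (Suc r)")
      case True
      have "cascade_shadow (Suc (Suc r)) (p + q)
          \<le> cascade_shadow (Suc (Suc r)) ((Suc n choose Suc (Suc r)) + p')"
        using p(2) True by (intro cascade_shadow_mono) simp
      also have "\<dots> = (Suc n choose Suc r) + cascade_shadow (Suc r) p'"
        using p(1) p'_le by (intro cascade_shadow_step) simp_all
      also have "cascade_shadow (Suc r) p' \<le> p' + cascade_shadow r p'"
        using Suc.IH[of 0 p'] by (simp only: cascade_shadow_zero) simp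
      finally show ?thesis
        using kkp p(2) by simp
    next
      case False
      then obtain n' q' where q: "Suc r < n'" "q = (n' choose Suc (Suc r)) + q'"
          "q' < n' choose Suc r"
        using cascade_exists[of q "Suc r"] by auto
      have kkq: "cascade_shadow (Suc (Suc r)) q = (n' choose Suc r) + cascade_shadow (Suc r) q'"
        using q by (simp only: cascade_shadow_step)
      have "n' = n"
      proof (rule antisym; rule ccontr)
        assume "\<not> n' \<le> n"
        then have "Suc n choose Suc r \<le> n' choose Suc r"
          by (intro binomial_right_mono) simp
        with kkq Suc.prems p show False by simp
      next
        assume "\<not> n \<le> n'"
        then have "Suc n' choose Suc (Suc r) \<le> n choose Suc (Suc r)"
          by (intro binomial_right_mono) simp
        with q False show False by simp
      qed
      have "cascade_shadow (Suc r) q' \<le> p'"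
        using kkq Suc.prems p \<open>n' = n\<close> by simp
      then have IH: "cascade_shadow (Suc r) (p' + q') \<le> p' + cascade_shadow r p'"
        by (rule Suc.IH)
      have "cascade_shadow (Suc (Suc r)) (p + q)
          = cascade_shadow (Suc (Suc r)) ((Suc n choose Suc (Suc r)) + (p' + q'))"
        using p(2) q(2) \<open>n' = n\<close> by (simp add: ac_simps)
      also have "\<dots> = (Suc n choose Suc r) + cascade_shadow (Suc r) (p' + q')"
        using p q \<open>n' = n\<close> by (intro cascade_shadow_step) simp_all
      finally show ?thesis
        using IH kkp p(2) by simp
    qed
  qed
qed

section \<open>Shadows, links and shifting\<close>

text \<open>
  A shadow without reference to a ground set or a uniformity, so that it applies to links and to
  shifted families over any type.
\<close>

definition lower_shadow :: "'a set set \<Rightarrow> 'a set set" where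
  "lower_shadow L = {E - {x} | E x. E \<in> L \<and> x \<in> E}"

definition link :: "'a \<Rightarrow> 'a set set \<Rightarrow> 'a set set" where
  "link v L = {E - {v} | E. E \<in> L \<and> v \<in> E}"

lemma link_eq_image: "link v L = (\<lambda>E. E - {v}) ` {E \<in> L. v \<in> E}"
  by (auto simp: link_def)

lemma card_link: "card (link v L) = card {E \<in> L. v \<in> E}"
  unfolding link_eq_image by (rule card_image) (auto simp: inj_on_def)

lemma finite_lower_shadow:
  assumes "finite L" "\<And>E. E \<in> L \<Longrightarrow> finite E"
  shows "finite (lower_shadow L)"
proof -
  have "lower_shadow L = (\<Union>E\<in>L. (\<lambda>x. E - {x}) ` E)"
    by (auto simp: lower_shadow_def)
  then show ?thesis using assms by simp
qed

text \<open>
  The shift operator of Erdos, Ko and Rado. An edge whose new position is already taken stays where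
  it is; this is what makes the operator injective on L.
\<close>

definition shift_edge :: "'a \<Rightarrow> 'a \<Rightarrow> 'a set set \<Rightarrow> 'a set \<Rightarrow> 'a set" where
  "shift_edge x v L E =
     (if x \<in> E \<and> v \<notin> E \<and> insert v (E - {x}) \<notin> L then insert v (E - {x}) else E)"

lemma inj_on_shift_edge:
  assumes "x \<noteq> v"
  shows "inj_on (shift_edge x v L) L"
proof (rule inj_onI)
  let ?moves = "\<lambda>E. x \<in> E \<and> v \<notin> E \<and> insert v (E - {x}) \<notin> L"
  fix E F assume *: "E \<in> L" "F \<in> L" "shift_edge x v L E = shift_edge x v L F"
  have inv: "insert x (insert v (G - {x}) - {v}) = G" if "x \<in> G" "v \<notin> G" for G
    using that assms by auto
  show "E = F"
  proof (cases "?moves E \<and> ?moves F")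
    case True
    then have "insert v (E - {x}) = insert v (F - {x})"
      using *(3) by (simp add: shift_edge_def)
    then show ?thesis
      using inv[of E] inv[of F] True by metis
  next
    case False
    with * show ?thesis
      by (metis shift_edge_def)
  qed
qed

text \<open>
  A set belongs to the shifted family if it was there and had no reason to move, or if it is the
  new position of an edge that moved.
\<close>

lemma mem_shift_iff:
  assumes "x \<noteq> v"
  shows "E \<in> shift_edge x v L ` L \<longleftrightarrow>
     (E \<in> L \<and> (x \<in> E \<and> v \<notin> E \<longrightarrow> insert v (E - {x}) \<in> L)) \<or>
     (E \<notin> L \<and> v \<in> E \<and> x \<notin> E \<and> insert x (E - {v}) \<in> L)" (is "_ \<longleftrightarrow> ?R")
proof
  assume "E \<in> shift_edge x v L ` L"
  then obtain F where F: "F \<in> L" "E = shift_edge x v L F" by blast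
  have "insert x (insert v (F - {x}) - {v}) = F" if "x \<in> F" "v \<notin> F"
    using that assms by auto
  with F assms show ?R by (auto simp: shift_edge_def split: if_splits)
next
  assume R: ?R
  show "E \<in> shift_edge x v L ` L"
  proof (cases "E \<in> L")
    case True
    then have "shift_edge x v L E = E" using R by (auto simp: shift_edge_def)
    with True show ?thesis by (metis imageI)
  next
    case False
    with R have E: "v \<in> E" "x \<notin> E" "insert x (E - {v}) \<in> L" by auto
    have "insert v (insert x (E - {v}) - {x}) = E" using E by auto
    then have "shift_edge x v L (insert x (E - {v})) = E"
      using E False assms by (simp add: shift_edge_def)
    with E(3) show ?thesis by (metis imageI)
  qed
qed

lemma lower_shadowI: "insert x S \<in> L \<Longrightarrow> x \<notin> S \<Longrightarrow> S \<in> lower_shadow L"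
  unfolding lower_shadow_def by (auto intro!: exI[of _ "insert x S"] exI[of _ x])

lemma lower_shadow_iff: "S \<in> lower_shadow L \<longleftrightarrow> (\<exists>x. x \<notin> S \<and> insert x S \<in> L)"
proof
  assume "S \<in> lower_shadow L"
  then obtain E x where "E \<in> L" "x \<in> E" "S = E - {x}"
    by (auto simp: lower_shadow_def)
  then show "\<exists>x. x \<notin> S \<and> insert x S \<in> L"
    by (auto intro!: exI[of _ x] simp: insert_absorb)
qed (auto intro: lower_shadowI)

text \<open>
  The shadow of a shifted family lies in the shifted shadow, so shifting does not enlarge the
  shadow. A set S of the shadow comes with an element y such that S with y is an edge of the
  shifted family; the cases are whether this edge is an old or a moved one, and whether y = v.
\<close>

lemma lower_shadow_shift:
  assumes "x \<noteq> v"
  shows "lower_shadow (shift_edge x v L ` L)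
           \<subseteq> shift_edge x v (lower_shadow L) ` lower_shadow L"
proof
  fix S assume "S \<in> lower_shadow (shift_edge x v L ` L)"
  then obtain y where y: "y \<notin> S" "insert y S \<in> shift_edge x v L ` L"
    by (auto simp: lower_shadow_iff)
  let ?D = "lower_shadow L"
  have I: "\<And>z T. insert z T \<in> L \<Longrightarrow> z \<notin> T \<Longrightarrow> T \<in> ?D"
    by (rule lower_shadowI)
  consider (kept) "insert y S \<in> L"
        "x \<in> insert y S \<and> v \<notin> insert y S \<Longrightarrow> insert v (insert y S - {x}) \<in> L"
    | (moved) "insert y S \<notin> L" "v \<in> insert y S" "x \<notin> insert y S"
        "insert x (insert y S - {v}) \<in> L"
    using y(2) unfolding mem_shift_iff[OF assms] by blast
  then show "S \<in> shift_edge x v ?D ` ?D"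
  proof cases
    case kept
    have "S \<in> ?D" using kept(1) y(1) by (rule I)
    moreover have "insert v (S - {x}) \<in> ?D" if "x \<in> S" "v \<notin> S"
    proof (cases "y = v")
      case True
      have "insert x (insert v (S - {x})) = insert y S" using True that by auto
      then show ?thesis using I[of x "insert v (S - {x})"] kept(1) assms by simp
    next
      case False
      then have "insert v (insert y S - {x}) \<in> L" using kept(2) that by simp
      moreover have "insert v (insert y S - {x}) = insert y (insert v (S - {x}))"
        using that y(1) by auto
      ultimately show ?thesis using I[of y "insert v (S - {x})"] False y(1) by simp
    qed
    ultimately show ?thesis unfolding mem_shift_iff[OF assms] by blast
  next
    case moved
    show ?thesis
    proof (cases "y = v")
      case True
      with y(1) moved(4) have "insert x S \<in> L" by simp
      then have "S \<in> ?D" using moved(3) by (intro I[of x]) simp_all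
      then show ?thesis using moved(3) unfolding mem_shift_iff[OF assms] by blast
    next
      case False
      then have vS: "v \<in> S" "x \<notin> S" "x \<noteq> y" using moved by auto
      have "insert x (insert y S - {v}) = insert y (insert x (S - {v}))"
        using False by auto
      then have "insert x (S - {v}) \<in> ?D"
        using moved(4) I[of y "insert x (S - {v})"] vS y(1) by simp
      then show ?thesis using vS unfolding mem_shift_iff[OF assms] by blast
    qed
  qed
qed

text \<open>
  Equivalently, the shadow of the edges that avoid v is contained in the link of v.
\<close>

definition stable_towards :: "'a \<Rightarrow> 'a set set \<Rightarrow> bool" where
  "stable_towards v L \<longleftrightarrow>
     (\<forall>E\<in>L. \<forall>x\<in>E. v \<notin> E \<longrightarrow> insert v (E - {x}) \<in> L)"

definition uniform :: "nat \<Rightarrow> 'a set set \<Rightarrow> bool" where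
  "uniform r L \<longleftrightarrow> finite L \<and> (\<forall>E\<in>L. finite E \<and> card E = r)"

lemma uniform_shift:
  assumes "uniform r L" "x \<noteq> v"
  shows "uniform r (shift_edge x v L ` L)"
proof -
  have "card (insert v (E - {x})) = card E" if "finite E" "x \<in> E" "v \<notin> E" for E :: "'a set"
    using that card.remove[of E x] by simp
  then show ?thesis
    using assms(1) by (auto simp: uniform_def shift_edge_def)
qed

text \<open>
  Among the families of the same size with a shadow that is not larger, one with the largest degree
  at v is stable: a shift towards v that changes it would keep it admissible and increase the degree.
  The maximum exists because the degree is at most the number of edges.
\<close>

lemma exists_stable_compression:
  fixes L :: "'a set set" and v :: 'a
  assumes "uniform r L"
  obtains M where "uniform r M" "card M = card L"
    "card (lower_shadow M) \<le> card (lower_shadow L)" "stable_towards v M"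
proof -
  let ?P = "\<lambda>M. uniform r M \<and> card M = card L \<and> card (lower_shadow M) \<le> card (lower_shadow L)"
  let ?deg = "\<lambda>M. card {E \<in> M. v \<in> E}"
  have "?P L" using assms by simp
  moreover have "?deg M \<le> card L" if "?P M" for M
    using that card_mono[of M "{E \<in> M. v \<in> E}"] by (simp add: uniform_def)
  ultimately have "\<exists>M. ?P M \<and> (\<forall>M'. ?P M' \<longrightarrow> ?deg M' \<le> ?deg M)"
    by (intro ex_has_greatest_nat[of ?P L ?deg "Suc (card L)"]) (simp_all add: less_Suc_eq_le)
  then obtain M where M: "?P M" and max: "\<And>M'. ?P M' \<Longrightarrow> ?deg M' \<le> ?deg M"
    by fast
  have fin: "finite M" "\<And>E. E \<in> M \<Longrightarrow> finite E" using M by (auto simp: uniform_def)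
  have "stable_towards v M"
    unfolding stable_towards_def
  proof (intro ballI impI, rule ccontr)
    fix E x assume E: "E \<in> M" "x \<in> E" "v \<notin> E" "insert v (E - {x}) \<notin> M"
    then have "x \<noteq> v" by blast
    let ?M = "shift_edge x v M ` M"
    have "card ?M = card M"
      using inj_on_shift_edge[OF \<open>x \<noteq> v\<close>] by (rule card_image)
    moreover have "card (lower_shadow ?M) \<le> card (lower_shadow M)"
    proof -
      have fin_shadow: "finite (lower_shadow M)"
        using fin by (rule finite_lower_shadow)
      have "card (lower_shadow ?M)
              \<le> card (shift_edge x v (lower_shadow M) ` lower_shadow M)"
        using fin_shadow lower_shadow_shift[OF \<open>x \<noteq> v\<close>] by (intro card_mono) simp_all
      also have "\<dots> \<le> card (lower_shadow M)"
        using fin_shadow by (rule card_image_le)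
      finally show ?thesis .
    qed
    ultimately have "?deg ?M \<le> ?deg M"
      using M uniform_shift[of r M x v] \<open>x \<noteq> v\<close> by (intro max) simp
    moreover have "{F \<in> M. v \<in> F} \<subset> {F \<in> ?M. v \<in> F}"
    proof
      show "{F \<in> M. v \<in> F} \<subseteq> {F \<in> ?M. v \<in> F}"
        unfolding mem_shift_iff[OF \<open>x \<noteq> v\<close>] by blast
      have "insert v (E - {x}) \<in> ?M"
        using E by (intro image_eqI[of _ _ E]) (simp_all add: shift_edge_def)
      with E(4) show "{F \<in> M. v \<in> F} \<noteq> {F \<in> ?M. v \<in> F}" by blast
    qed
    then have "?deg M < ?deg ?M"
      using fin by (intro psubset_card_mono) simp_all
    ultimately show False by simp
  qed
  with M show ?thesis using that by blast
qed

section \<open>The Kruskal-Katona theorem\<close>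

lemma link_iff: "S \<in> link v L \<longleftrightarrow> v \<notin> S \<and> insert v S \<in> L"
  unfolding link_def by (auto simp: insert_absorb intro: exI[of _ "insert v S"])

lemma lower_shadow_link: "insert v ` lower_shadow (link v L) \<subseteq> lower_shadow L"
proof
  fix T assume "T \<in> insert v ` lower_shadow (link v L)"
  then obtain S x where "T = insert v S" "x \<notin> S" "v \<notin> insert x S" "insert v (insert x S) \<in> L"
    by (auto simp: lower_shadow_iff link_iff)
  then show "T \<in> lower_shadow L"
    by (intro lower_shadowI[of x]) (auto simp: insert_commute)
qed

lemma card_insert_lower_shadow_link:
  "card (insert v ` lower_shadow (link v L)) = card (lower_shadow (link v L))"
proof (rule card_image)
  have "v \<notin> S" if "S \<in> lower_shadow (link v L)" for S
    using that by (auto simp: lower_shadow_iff link_iff)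
  then show "inj_on (insert v) (lower_shadow (link v L))"
    by (intro inj_onI) (metis insert_ident)
qed

lemma uniform_link:
  assumes "uniform (Suc r) L"
  shows "uniform r (link v L)"
  using assms by (auto simp: uniform_def link_eq_image)

text \<open>
  Frankl's proof. For a family M stable towards v, the edges avoiding v have their shadow inside the
  link of v, and the shadow of M contains both the link (as the sets without v) and, with v adjoined,
  the shadow of the link. By induction both the shadow of the edges avoiding v and that of the link
  are bounded by the cascade function; \<open>cascade_shadow_split\<close> combines the two bounds.
\<close>

theorem kruskal_katona:
  "uniform r L \<Longrightarrow> cascade_shadow r (card L) \<le> card (lower_shadow L)"
proof (induction r arbitrary: L)
  case 0
  show ?case by simp
next
  case (Suc r)
  note IH_r = Suc.IH
  from Suc.prems show ?case
  proof (induction "card L" arbitrary: L rule: less_induct)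
    case less
    show ?case
    proof (cases "L = {}")
      case False
      then obtain E v where E: "E \<in> L" "v \<in> E"
        using less.prems by (fastforce simp: uniform_def)
      obtain M where M: "uniform (Suc r) M" "card M = card L"
          "card (lower_shadow M) \<le> card (lower_shadow L)" "stable_towards v M"
        using exists_stable_compression[OF less.prems] .
      let ?M0 = "{F \<in> M. v \<notin> F}" and ?M1 = "link v M"
      have fin: "finite M" "\<And>F. F \<in> M \<Longrightarrow> finite F"
        using M(1) by (auto simp: uniform_def)
      have U0: "uniform (Suc r) ?M0"
        using M(1) by (auto simp: uniform_def)
      have U1: "uniform r ?M1"
        using M(1) by (rule uniform_link)
      have card_M: "card M = card ?M1 + card ?M0"
      proof -
        have "M = {F \<in> M. v \<in> F} \<union> ?M0" by blast
        then have "card M = card ({F \<in> M. v \<in> F} \<union> ?M0)" by simp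
        also have "\<dots> = card {F \<in> M. v \<in> F} + card ?M0"
          using fin by (intro card_Un_disjoint) auto
        finally show ?thesis by (simp add: card_link)
      qed
      have M1_ne: "?M1 \<noteq> {}"
      proof -
        have "M \<noteq> {}"
          using M(2) E(1) less.prems by (auto simp: uniform_def)
        then obtain F where F: "F \<in> M" by blast
        then have "F \<noteq> {}" using M(1) by (auto simp: uniform_def)
        then obtain x where x: "x \<in> F" by blast
        show ?thesis
        proof (cases "v \<in> F")
          case True
          with F show ?thesis by (auto simp: link_def)
        next
          case False
          then have "insert v (F - {x}) \<in> M"
            using M(4) F x by (auto simp: stable_towards_def)
          then show ?thesis by (auto simp: link_def)
        qed
      qed
      have "card ?M0 < card L"
        using M1_ne card_M M(2) U1 by (simp add: uniform_def card_gt_0_iff)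
      then have "cascade_shadow (Suc r) (card ?M0) \<le> card (lower_shadow ?M0)"
        using U0 by (rule less.hyps)
      also have "\<dots> \<le> card ?M1"
      proof (rule card_mono)
        show "finite ?M1" using U1 by (simp add: uniform_def)
        show "lower_shadow ?M0 \<subseteq> ?M1"
        proof
          fix S assume "S \<in> lower_shadow ?M0"
          then obtain x where x: "x \<notin> S" "insert x S \<in> M" "v \<notin> insert x S"
            by (auto simp: lower_shadow_iff)
          then have "insert v (insert x S - {x}) \<in> M"
            using M(4) unfolding stable_towards_def by blast
          with x show "S \<in> ?M1" by (simp add: link_iff)
        qed
      qed
      finally have "cascade_shadow (Suc r) (card M) \<le> card ?M1 + cascade_shadow r (card ?M1)"
        unfolding card_M by (rule cascade_shadow_split)
      also have "\<dots> \<le> card ?M1 + card (lower_shadow ?M1)"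
        using IH_r[OF U1] by simp
      also have "\<dots> = card (?M1 \<union> insert v ` lower_shadow ?M1)"
      proof -
        have "finite (lower_shadow ?M1)"
          using U1 by (intro finite_lower_shadow) (auto simp: uniform_def)
        moreover have "?M1 \<inter> insert v ` lower_shadow ?M1 = {}"
          by (auto simp: link_iff)
        ultimately show ?thesis
          using U1 by (simp add: card_Un_disjoint card_insert_lower_shadow_link uniform_def)
      qed
      also have "\<dots> \<le> card (lower_shadow M)"
      proof (rule card_mono)
        show "finite (lower_shadow M)" using fin by (rule finite_lower_shadow)
        show "?M1 \<union> insert v ` lower_shadow ?M1 \<subseteq> lower_shadow M"
          using lower_shadow_link[of v M] by (auto simp: link_iff intro: lower_shadowI)
      qed
      finally show ?thesis using M(2,3) by simp
    qed simp
  qed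
qed

section \<open>How small the shadow ratio can be below a given size\<close>

text \<open>
  As long as m is at most the number of r-subsets of an n-set, n = r+b, the ratio of shadow size to m
  is at least that of the complete r-uniform hypergraph on n vertices, which is r/(b+1). Splitting
  off the leading term of m keeps n-r, and so b+1, unchanged for the remainder.
\<close>

lemma cascade_shadow_ratio:
  "m \<le> (r + b) choose r \<Longrightarrow> r * m \<le> (b + 1) * cascade_shadow r m"
proof (induction r arbitrary: b m)
  case 0
  show ?case by simp
next
  case (Suc r)
  note IH_r = Suc.IH
  from Suc.prems show ?case
  proof (induction b)
    case 0
    then have "m = 0 \<or> m = Suc 0" by auto
    then show ?case by (auto simp: cascade_shadow_one)
  next
    case (Suc b)
    let ?n = "Suc r + b"
    show ?case
    proof (cases "m \<le> ?n choose Suc r")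
      case True
      then show ?thesis using Suc.IH by simp
    next
      case False
      then obtain m' where m': "m = (?n choose Suc r) + m'"
        by (metis nat_le_linear le_Suc_ex)
      then have m'_le: "m' \<le> ?n choose r"
        using Suc.prems by simp
      have "cascade_shadow (Suc r) m = (?n choose r) + cascade_shadow r m'"
        unfolding m' using m'_le by (intro cascade_shadow_step) simp_all
      moreover have "r * m' \<le> (b + 2) * cascade_shadow r m'"
        using IH_r[of m' "Suc b"] m'_le by simp
      moreover have "Suc r * (?n choose Suc r) = Suc b * (?n choose r)"
        using Suc_times_binomial_add[of r b] by simp
      ultimately show ?thesis
        using m' m'_le by (simp add: algebra_simps)
    qed
  qed
qed

text \<open>
  The number of r-sets that contain a given (r-1)-set in an (r+b)-set is b+1. If fewer than b+1 sets
  are missing from the complete hypergraph, no set can be missing from its shadow.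
  The deficit and b are both preserved when the leading term of m is split off.
\<close>

lemma cascade_shadow_near_top:
  "(Suc r + b) choose Suc r < m + (b + 1) \<Longrightarrow> (Suc r + b) choose r \<le> cascade_shadow (Suc r) m"
proof (induction r arbitrary: m)
  case 0
  then have "0 < m" by simp
  then show ?case by (simp add: cascade_shadow_Suc_0)
next
  case (Suc r)
  let ?n = "Suc r + b"
  show ?case
  proof (cases "Suc ?n choose Suc (Suc r) \<le> m")
    case True
    then have "cascade_shadow (Suc (Suc r)) (Suc ?n choose Suc (Suc r))
        \<le> cascade_shadow (Suc (Suc r)) m"
      by (rule cascade_shadow_mono)
    then show ?thesis by (simp add: cascade_shadow_binomial del: binomial_Suc_Suc)
  next
    case False
    show ?thesis
    proof (cases b)
      case 0
      then have "m = 0" using False by simp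
      then show ?thesis using Suc.prems 0 by simp
    next
      case (Suc c)
      (* Fewer than b + 1 sets are missing, so m reaches the binomial coefficient with index ?n. *)
      have "b + 1 \<le> ?n choose Suc r"
        using one_plus_mult_le_binomial[of "Suc r" ?n] Suc by (simp del: binomial_Suc_Suc)
      then have "?n choose Suc (Suc r) \<le> m"
        using Suc.prems by simp
      then obtain m' where m': "m = (?n choose Suc (Suc r)) + m'"
        using le_Suc_ex by blast
      have "cascade_shadow (Suc (Suc r)) m = (?n choose Suc r) + cascade_shadow (Suc r) m'"
        unfolding m' using False m' Suc by (intro cascade_shadow_step) simp_all
      moreover have "?n choose r \<le> cascade_shadow (Suc r) m'"
        using Suc.prems m' by (intro Suc.IH) simp
      ultimately show ?thesis by simp
    qed
  qed
qed

text \<open>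
  The points (T' + m, T + m y / x) with m at most x lie on a line that ends in (X, Y). If its slope
  y/x is at most Y/X, the line stays above the ray from the origin to (X, Y), and so does the point
  (T' + m, T + k).
\<close>

lemma mediant_bound:
  fixes m k x y X Y T T' :: real
  assumes "m * y \<le> k * x" "m \<le> x" "0 < x" "y * X \<le> x * Y" "X = T' + x" "Y = T + y" "0 \<le> X"
  shows "(T' + m) * Y \<le> (T + k) * X"
proof -
  have "0 \<le> (x - m) * (x * Y - y * X)"
    using assms by simp
  moreover have "m * y * X \<le> k * x * X"
    using assms by (simp add: mult_right_mono)
  ultimately have "x * ((T' + m) * Y) \<le> x * ((T + k) * X)"
    unfolding assms(5,6) by (simp add: algebra_simps)
  then show ?thesis
    using assms(3) by simp
qed

text \<open>
  With C and T the numbers of subsets of an (r+b)-set of sizes r-1 and r, where r = j+2, and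
  a = b+1, the claim is that m edges with m \<le> T - a have at least m (C-1)/(T-a) sets in their shadow;
  equality holds for m = T - a.
  If m is so small that its edges fit on one vertex less, the general ratio bound is already
  stronger than the claim. Otherwise the leading term of m is split off, and the remainder m' satisfies
  the same claim in uniformity r-1 with the same a. It has to be checked that the ratio in that claim
  is at most (C-1)/(T-a); this comes down to C1 \<ge> (r-1)^2 for the number C1 of (r-2)-subsets of an
  (r+b-1)-set, which is where b \<ge> 2 enters.
\<close>

lemma cascade_shadow_below_top:
  assumes b: "2 \<le> b"
  shows "m + (b + 1) \<le> (j + 2 + b) choose (j + 2) \<Longrightarrow>
    real m * (real ((j + 2 + b) choose (j + 1)) - 1)
      \<le> real (cascade_shadow (j + 2) m) * (real ((j + 2 + b) choose (j + 2)) - (real b + 1))"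
proof (induction j arbitrary: m)
  case 0
  obtain c where c: "b = Suc c" using b by (cases b) auto
  have top: "(b + 2) choose 2 = ((b + 1) choose 2) + (b + 1)"
    by (simp add: numeral_2_eq_2)
  have "m + (b + 1) \<le> (b + 2) choose 2"
    using 0 by (simp only: add_0 add.commute)
  then have "m \<le> (b + 1) choose 2"
    using top by linarith
  moreover have "b + 1 = 2 + c"
    using c by simp
  ultimately have "m \<le> (2 + c) choose 2"
    by (simp only:)
  from cascade_shadow_ratio[OF this] have "2 * m \<le> b * cascade_shadow 2 m"
    using c by simp
  then have "2 * real m \<le> real b * real (cascade_shadow 2 m)"
    using of_nat_mono[where 'a = real, of "2 * m" "b * cascade_shadow 2 m"] by simp
  then have "2 * real m * (real b + 1) \<le> real b * real (cascade_shadow 2 m) * (real b + 1)"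
    by (rule mult_right_mono) simp
  moreover have "2 * ((b + 1) choose 2) = (b + 1) * b"
    using Suc_times_binomial[of 1 b] by (simp add: numeral_2_eq_2)
  from arg_cong[OF this, of real] have "2 * real ((b + 1) choose 2) = (real b + 1) * real b"
    by (simp only: of_nat_add of_nat_mult of_nat_numeral of_nat_1)
  then have "real b * real (cascade_shadow 2 m) * (real b + 1)
      = real (cascade_shadow 2 m) * (2 * real ((b + 1) choose 2))"
    by (simp only: ac_simps)
  ultimately have "real m * (real b + 1) \<le> real (cascade_shadow 2 m) * real ((b + 1) choose 2)"
    by linarith
  moreover have "real ((b + 2) choose 2) - (real b + 1) = real ((b + 1) choose 2)"
    unfolding top by simp
  moreover have "real ((b + 2) choose 1) - 1 = real b + 1"
    by simp
  ultimately show ?case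
    by (simp only: add_0 add.commute[of 2 b])
next
  case (Suc j)
  let ?n = "j + 2 + b"
  define T C where "T = real (Suc ?n choose (j + 3))" and "C = real (Suc ?n choose (j + 2))"
  define T1 C1 where "T1 = real (?n choose (j + 2))" and "C1 = real (?n choose (j + 1))"
  define T0 where "T0 = real (?n choose (j + 3))"
  define a where "a = real b + 1"
  define K where "K = real (cascade_shadow (j + 3) m)"
  have T_eq: "T = T1 + T0" and C_eq: "C = C1 + T1"
    by (simp_all add: T_def T1_def T0_def C_def C1_def numeral_3_eq_3 numeral_2_eq_2)
  have "(j + 3) * (Suc ?n choose (j + 3)) = (b + 1) * (Suc ?n choose (j + 2))"
    using Suc_times_binomial_add[of "j + 2" b] by (simp add: numeral_3_eq_3 del: binomial_Suc_Suc)
  from arg_cong[OF this, of real] have TC: "(real j + 3) * T = a * C"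
    by (simp only: T_def C_def a_def of_nat_add of_nat_mult of_nat_numeral of_nat_1)
  have "(j + 2) * (?n choose (j + 2)) = (b + 1) * (?n choose (j + 1))"
    using Suc_times_binomial_add[of "j + 1" b] by (simp del: binomial_Suc_Suc)
  from arg_cong[OF this, of real] have TC1: "(real j + 2) * T1 = a * C1"
    by (simp only: T1_def C1_def a_def of_nat_add of_nat_mult of_nat_numeral of_nat_1)
  have "(j + 2)\<^sup>2 \<le> ?n choose (j + 1)"
    using square_le_binomial[of "j + 1" ?n] b by simp
  from of_nat_mono[OF this, where 'a = real] have C1_ge: "(real j + 2)\<^sup>2 \<le> C1"
    by (simp only: C1_def of_nat_add of_nat_power of_nat_numeral)
  have "1 + (j + 2) * (b + 1) \<le> Suc ?n choose (j + 2)"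
    using one_plus_mult_le_binomial[of "j + 2" "Suc ?n"] by (simp del: binomial_Suc_Suc)
  from of_nat_mono[OF this, where 'a = real] have C_ge: "1 + (real j + 2) * a \<le> C"
    by (simp only: C_def a_def of_nat_add of_nat_mult of_nat_numeral of_nat_1)
  have a_ge: "3 \<le> a" using b by (simp add: a_def)
  (* The factor r turns T - a into a multiple of a, which clears all denominators below. *)
  have top: "(real j + 3) * (T - a) = a * (C - (real j + 3))"
    using TC by (simp add: algebra_simps)
  have main: "real m * (C - 1) \<le> K * (T - a)"
  proof (cases "m \<le> ?n choose (j + 3)")
    case True
    obtain c where c: "b = Suc c" using b by (cases b) auto
    have "(j + 3) * m \<le> b * cascade_shadow (j + 3) m"
      using cascade_shadow_ratio[of m "j + 3" c] True c
      by (simp add: numeral_3_eq_3 del: binomial_Suc_Suc)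
    from of_nat_mono[OF this, where 'a = real] have "(real j + 3) * real m \<le> (a - 1) * K"
      by (simp only: K_def a_def of_nat_add of_nat_mult of_nat_numeral add_diff_cancel_right')
    moreover have "0 \<le> (real j + 2) * a"
      using a_ge by simp
    then have "0 \<le> C - 1"
      using C_ge by linarith
    ultimately have "(real j + 3) * real m * (C - 1) \<le> (a - 1) * K * (C - 1)"
      by (rule mult_right_mono)
    also have "(a - 1) * (C - 1) \<le> a * (C - (real j + 3))"
      using C_ge by (simp add: algebra_simps)
    then have "K * ((a - 1) * (C - 1)) \<le> K * ((real j + 3) * (T - a))"
      unfolding top by (rule mult_left_mono) (simp add: K_def)
    then have "(a - 1) * K * (C - 1) \<le> (real j + 3) * (K * (T - a))"
      by (simp add: ac_simps)
    finally have "(real j + 3) * (real m * (C - 1)) \<le> (real j + 3) * (K * (T - a))"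
      by (simp add: ac_simps)
    then show ?thesis
      by (rule mult_left_le_imp_le) simp
  next
    case False
    then obtain m' where m': "m = (?n choose (j + 3)) + m'"
      by (metis nat_le_linear le_Suc_ex)
    have m'_le: "m' + (b + 1) \<le> ?n choose (j + 2)"
      using Suc.prems m' by (simp add: numeral_3_eq_3 numeral_2_eq_2)
    have "cascade_shadow (Suc (j + 2)) m = (?n choose (j + 2)) + cascade_shadow (j + 2) m'"
      using cascade_shadow_step[of "j + 2" ?n m'] m' m'_le b
      by (simp add: numeral_3_eq_3 del: binomial_Suc_Suc)
    then have K_eq: "K = T1 + real (cascade_shadow (j + 2) m')"
      by (simp add: K_def T1_def numeral_3_eq_3)
    have IH: "real m' * (C1 - 1) \<le> real (cascade_shadow (j + 2) m') * (T1 - a)"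
      unfolding C1_def T1_def a_def using m'_le by (rule Suc.IH)
    have top1: "(real j + 2) * (T1 - a) = a * (C1 - (real j + 2))"
      using TC1 by (simp add: algebra_simps)
    have C1_gt: "(real j + 2) + 1 \<le> C1"
    proof -
      have "(real j + 2)\<^sup>2 = real j * real j + 4 * real j + 4"
        by (simp add: power2_eq_square algebra_simps)
      moreover have "0 \<le> real j * real j" by simp
      ultimately show ?thesis using C1_ge by linarith
    qed
    have "0 < (real j + 2) * (T1 - a)"
      unfolding top1 using C1_gt a_ge by simp
    then have x_pos: "0 < T1 - a"
      by (simp add: zero_less_mult_iff)
    from m'_le have m'_le': "real m' \<le> T1 - a"
      unfolding T1_def a_def by linarith
    have "(C1 - 1) * (T - a) \<le> (T1 - a) * (C - 1)"
    proof -
      have "(real j + 2) * (C1 - 1) \<le> (real j + 3) * (C1 - (real j + 2))"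
        using C1_ge by (simp add: power2_eq_square algebra_simps)
      moreover have "C - (real j + 3) \<le> C - 1" "0 \<le> C - 1"
        using C1_gt by (simp_all add: C_eq T1_def)
      moreover have "0 \<le> (real j + 3) * (C1 - (real j + 2))"
        using C1_gt by simp
      moreover have "0 \<le> (real j + 2) * (C1 - 1)"
        using C1_gt by simp
      ultimately have "(real j + 2) * (C1 - 1) * (C - (real j + 3))
          \<le> (real j + 3) * (C1 - (real j + 2)) * (C - 1)"
        by (meson mult_left_mono mult_right_mono order_trans)
      then have "a * ((real j + 2) * (C1 - 1) * (C - (real j + 3)))
          \<le> a * ((real j + 3) * (C1 - (real j + 2)) * (C - 1))"
        using a_ge by (intro mult_left_mono) simp_all
      moreover have "a * ((real j + 2) * (C1 - 1) * (C - (real j + 3)))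
          = (real j + 2) * (C1 - 1) * ((real j + 3) * (T - a))"
        unfolding top by (simp add: ac_simps)
      moreover have "a * ((real j + 3) * (C1 - (real j + 2)) * (C - 1))
          = (real j + 3) * (C - 1) * ((real j + 2) * (T1 - a))"
        unfolding top1 by (simp add: ac_simps)
      ultimately have "(real j + 2) * (C1 - 1) * ((real j + 3) * (T - a))
          \<le> (real j + 3) * (C - 1) * ((real j + 2) * (T1 - a))"
        by linarith
      then have "(real j + 2) * (real j + 3) * ((C1 - 1) * (T - a))
          \<le> (real j + 2) * (real j + 3) * ((T1 - a) * (C - 1))"
        by (simp only: ac_simps)
      then show ?thesis
        by (rule mult_left_le_imp_le) simp
    qed
    (* The point (T - a, C - 1) is reached at the largest remainder m' = T1 - a. *)
    then have "(T0 + real m') * (C - 1) \<le> (T1 + real (cascade_shadow (j + 2) m')) * (T - a)"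
      using IH m'_le' x_pos
      by (intro mediant_bound[where x = "T1 - a" and y = "C1 - 1"])
         (simp_all add: T_eq C_eq T0_def)
    then show ?thesis
      by (simp add: K_eq m' T0_def)
  qed
  then show ?case
    by (simp add: T_def C_def K_def a_def numeral_3_eq_3 numeral_2_eq_2 del: binomial_Suc_Suc)
qed

text \<open>
  With C, T and a as before: for m > T - a the shadow bound C and m \<le> d suffice. For m \<le> T - a it remains to check that
  C (T-a) \<le> (C-1) d at the smallest admissible d. Multiplied by r, and with r T = a C,
  the two sides differ there by exactly (r-1) a.
\<close>

lemma cascade_shadow_ge_linear:
  fixes d :: real
  assumes r: "2 \<le> r" and b: "2 \<le> b"
    and d_ge: "real ((r + b) choose r) - (real r - 1) / real r * (real b + 1) \<le> d"
    and m_le: "real m \<le> d"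
  shows "real m * real ((r + b) choose (r - 1)) \<le> real (cascade_shadow r m) * d"
proof -
  obtain j where j: "r = j + 2" using r le_Suc_ex by (metis add.commute)
  let ?n = "j + 2 + b"
  define T C where "T = real (?n choose (j + 2))" and "C = real (?n choose (j + 1))"
  define a where "a = real b + 1"
  define K where "K = real (cascade_shadow (j + 2) m)"
  have a_pos: "0 < a" by (simp add: a_def)
  have "real r = real j + 2" "real r - 1 = real j + 1"
    using j by simp_all
  then have d_ge': "T - (real j + 1) / (real j + 2) * a \<le> d"
    using d_ge by (simp only: T_def a_def j)
  have "real m * C \<le> K * d"
  proof (cases "m + (b + 1) \<le> ?n choose (j + 2)")
    case False
    then have "?n choose (j + 1) \<le> cascade_shadow (j + 2) m"
      using cascade_shadow_near_top[of "j + 1" b m]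
      by (simp add: numeral_2_eq_2 del: binomial_Suc_Suc)
    then have "C \<le> K" by (simp add: C_def K_def)
    then have "C * real m \<le> K * d"
      using m_le by (intro mult_mono) (simp_all add: K_def)
    then show ?thesis by (simp add: mult.commute)
  next
    case True
    then have *: "real m * (C - 1) \<le> K * (T - a)"
      unfolding C_def T_def K_def a_def by (rule cascade_shadow_below_top[OF b])
    have "(j + 2) * (?n choose (j + 2)) = (b + 1) * (?n choose (j + 1))"
      using Suc_times_binomial_add[of "j + 1" b] by (simp del: binomial_Suc_Suc)
    from arg_cong[OF this, of real] have TC: "(real j + 2) * T = a * C"
      by (simp only: T_def C_def a_def of_nat_add of_nat_mult of_nat_numeral of_nat_1)
    have "1 + (j + 1) * (b + 1) \<le> ?n choose (j + 1)"
      using one_plus_mult_le_binomial[of "j + 1" ?n] by (simp del: binomial_Suc_Suc)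
    then have C_gt: "1 < C"
      unfolding C_def by simp
    have "(real j + 2) * (C * (T - a)) \<le> (real j + 2) * ((C - 1) * d)"
    proof -
      have "(real j + 2) * T - (real j + 1) * a \<le> (real j + 2) * d"
      proof -
        have "(real j + 2) * (T - (real j + 1) / (real j + 2) * a) \<le> (real j + 2) * d"
          using d_ge' by (intro mult_left_mono) simp_all
        then show ?thesis by (simp add: right_diff_distrib)
      qed
      then have "(C - 1) * ((real j + 2) * T - (real j + 1) * a) \<le> (C - 1) * ((real j + 2) * d)"
        using C_gt by (intro mult_left_mono) simp_all
      moreover have "(C - 1) * ((real j + 2) * T - (real j + 1) * a)
          = (real j + 2) * (C * (T - a)) + (real j + 1) * a"
      proof -
        have "(C - 1) * ((real j + 2) * T - (real j + 1) * a)
            - ((real j + 2) * (C * (T - a)) + (real j + 1) * a) = a * C - (real j + 2) * T"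
          by (simp add: algebra_simps)
        then show ?thesis using TC by simp
      qed
      moreover have "0 \<le> (real j + 1) * a" using a_pos by simp
      ultimately have "(real j + 2) * (C * (T - a)) \<le> (C - 1) * ((real j + 2) * d)"
        by linarith
      then show ?thesis by (simp only: mult.left_commute[of "C - 1"])
    qed
    then have **: "C * (T - a) \<le> (C - 1) * d"
      by (rule mult_left_le_imp_le) simp
    have "real m * C * (C - 1) \<le> K * (T - a) * C"
      using mult_right_mono[OF *, of C] C_gt by (simp add: ac_simps)
    also have "\<dots> \<le> K * d * (C - 1)"
      using mult_left_mono[OF **, of K] by (simp add: K_def ac_simps)
    finally show ?thesis
      using C_gt by simp
  qed
  then show ?thesis
    by (simp add: C_def K_def j)
qed

section \<open>Counting over the links\<close>

lemma sum_card_incident: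
  assumes "finite V" "finite F" "\<And>S. S \<in> F \<Longrightarrow> S \<subseteq> V \<and> card S = s"
  shows "(\<Sum>v\<in>V. card {S \<in> F. v \<in> S}) = s * card F"
proof -
  have "card {v \<in> V. v \<in> S} = s" if "S \<in> F" for S
    using assms(3)[OF that] by (simp add: Collect_conj_eq Int_absorb1)
  then have "(\<Sum>v\<in>V. card {S \<in> F. v \<in> S}) = sum (\<lambda>_. s) F"
    using assms(1,2) by (intro sum_multicount_gen) auto
  then show ?thesis by simp
qed

text \<open>
  A lower bound c/d for the ratio of shadow size to size that holds in all links passes to H with
  the factor (r+1)/r: an edge is counted in r+1 links, while a set of the shadow of H is counted in
  the shadows of at most r links.
\<close>

lemma shadow_ratio_from_links:
  fixes c d :: real
  assumes "finite V" "uniform (Suc r) H" "\<And>E. E \<in> H \<Longrightarrow> E \<subseteq> V"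
    and links: "\<And>v. v \<in> V \<Longrightarrow>
        real (card (link v H)) * c \<le> real (card (lower_shadow (link v H))) * d"
    and "0 \<le> d"
  shows "real (Suc r) * real (card H) * c \<le> real r * real (card (lower_shadow H)) * d"
proof -
  let ?D = "lower_shadow H"
  have fin: "finite H" "finite ?D"
    using assms(2) by (auto simp: uniform_def intro: finite_lower_shadow)
  have D: "S \<subseteq> V \<and> card S = r" if "S \<in> ?D" for S
  proof -
    obtain x where "x \<notin> S" "insert x S \<in> H" using \<open>S \<in> ?D\<close> lower_shadow_iff by metis
    then show ?thesis using assms(2) assms(3)[of "insert x S"] by (auto simp: uniform_def)
  qed
  have link_le: "card (lower_shadow (link v H)) \<le> card {S \<in> ?D. v \<in> S}" for v
  proof -
    have "card (insert v ` lower_shadow (link v H)) \<le> card {S \<in> ?D. v \<in> S}"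
      using fin lower_shadow_link[of v H] by (intro card_mono) auto
    then show ?thesis by (simp add: card_insert_lower_shadow_link)
  qed
  have "Suc r * card H = (\<Sum>v\<in>V. card (link v H))"
    unfolding card_link using assms(1-3) fin
    by (intro sum_card_incident[symmetric]) (auto simp: uniform_def)
  from arg_cong[OF this, of real]
  have "real (Suc r) * real (card H) * c = (\<Sum>v\<in>V. real (card (link v H)) * c)"
    by (simp only: of_nat_mult of_nat_sum sum_distrib_right)
  also have "\<dots> \<le> (\<Sum>v\<in>V. real (card {S \<in> ?D. v \<in> S}) * d)"
  proof (rule sum_mono)
    fix v assume "v \<in> V"
    then have "real (card (link v H)) * c \<le> real (card (lower_shadow (link v H))) * d"
      by (rule links)
    also have "\<dots> \<le> real (card {S \<in> ?D. v \<in> S}) * d"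
      using link_le \<open>0 \<le> d\<close> by (intro mult_right_mono) simp_all
    finally show "real (card (link v H)) * c \<le> real (card {S \<in> ?D. v \<in> S}) * d" .
  qed
  also have "\<dots> = real (r * card ?D) * d"
  proof -
    have "(\<Sum>v\<in>V. card {S \<in> ?D. v \<in> S}) = r * card ?D"
      using assms(1) fin(2) D by (rule sum_card_incident)
    from arg_cong[OF this, of real] show ?thesis
      by (simp only: of_nat_sum sum_distrib_right[symmetric])
  qed
  finally show ?thesis by simp
qed

lemma shadow_eq_lower_shadow:
  assumes "H \<subseteq> nsets {1..n} k" "1 \<le> k"
  shows "shadow n k H = lower_shadow H"
proof (intro set_eqI iffI)
  fix S assume "S \<in> shadow n k H"
  then obtain E where E: "S \<in> nsets {1..n} (k - 1)" "E \<in> H" "S \<subseteq> E"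
    by (auto simp: shadow_def)
  then have fin: "finite E" "card E = k" "finite S" "card S = k - 1"
    using assms(1) by (auto simp: nsets_def)
  then have "card (E - S) = 1"
    using E(3) assms(2) by (simp add: card_Diff_subset)
  then obtain x where "E - S = {x}" by (auto simp: card_1_singleton_iff)
  then have "E = insert x S" "x \<notin> S" using E(3) by auto
  with E(2) show "S \<in> lower_shadow H" by (auto intro: lower_shadowI)
next
  fix S assume "S \<in> lower_shadow H"
  then obtain x where x: "x \<notin> S" "insert x S \<in> H" by (auto simp: lower_shadow_iff)
  then have "insert x S \<subseteq> {1..n}" "finite S" "card (insert x S) = k"
    using assms(1) by (auto simp: nsets_def)
  with x show "S \<in> shadow n k H"
    by (auto simp: shadow_def nsets_def intro!: bexI[of _ "insert x S"])
qed

theorem theorem1p7: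
  fixes n k t :: nat and H :: "nat set set" and d :: real
  assumes "k \<ge> 3" and "t \<ge> k"
    and "uniform_hypergraph n k H" and "H \<noteq> {}"
    and "degree_bound n H d"
    and "real ((t + 1) choose (k - 1)) - (real k - 2) / (real k - 1) * (real t - real k + 3) \<le> d"
    and "d < real ((t + 1) choose (k - 1))"
  shows "real (card (shadow n k H)) / real (card H)
           \<ge> real k * real ((t + 1) choose (k - 2)) / ((real k - 1) * d)
       \<and> real k * real ((t + 1) choose (k - 2)) / ((real k - 1) * d)
           = real ((t + 2) choose (k - 1))
             / (real ((t + 2) choose k)
                - (real t + 2) / real k * (real ((t + 1) choose (k - 1)) - d))"
proof -
  obtain r where r: "k = Suc r" "2 \<le> r"
    using assms(1) by (cases k) auto
  obtain b where b: "t + 1 = r + b" "2 \<le> b"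
    using assms(2) r le_Suc_ex[of "r + 2" "t + 1"] by (auto simp: ac_simps)
  have sub: "H \<subseteq> nsets {1..n} k"
    using assms(3) by (simp add: uniform_hypergraph_def)
  have fin: "finite H"
    using sub by (rule finite_subset) (simp add: finite_imp_finite_nsets)
  have unif: "uniform (Suc r) H"
    using sub fin r by (auto simp: uniform_def nsets_def)
  have H_sub: "E \<subseteq> {1..n}" if "E \<in> H" for E
    using sub that by (auto simp: nsets_def)
  have deg_le: "real (card (link v H)) \<le> d" if "v \<in> {1..n}" for v
  proof -
    have "card (link v H) \<le> max_degree n H"
      unfolding max_degree_def card_link using that by (intro Max_ge) auto
    then show ?thesis
      using assms(5) by (simp add: degree_bound_def)
  qed
  have d_pos: "0 < d"
  proof -
    obtain E where E: "E \<in> H" using assms(4) by blast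
    then have "E \<noteq> {}" using unif by (auto simp: uniform_def)
    then obtain v where v: "v \<in> E" by blast
    have "link v H \<noteq> {}" using E v by (auto simp: link_def)
    then have "0 < card (link v H)"
      using uniform_link[OF unif] by (simp add: uniform_def card_gt_0_iff)
    then show ?thesis using deg_le[of v] H_sub[OF E] v by fastforce
  qed
  have d_ge: "real ((r + b) choose r) - (real r - 1) / real r * (real b + 1) \<le> d"
  proof -
    have "real t - real k + 3 = real b + 1" "real k - 2 = real r - 1" "real k - 1 = real r"
        "k - 1 = r"
      using b(1) r(1) by linarith+
    then show ?thesis using assms(6) by (simp only: b(1))
  qed
  let ?c = "real ((t + 1) choose (k - 2))"
  have links: "real (card (link v H)) * ?c \<le> real (card (lower_shadow (link v H))) * d"
    if "v \<in> {1..n}" for v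
  proof -
    have "real (card (link v H)) * ?c \<le> real (cascade_shadow r (card (link v H))) * d"
      using cascade_shadow_ge_linear[OF r(2) b(2) d_ge deg_le[OF that]] b(1) r(1) by simp
    also have "\<dots> \<le> real (card (lower_shadow (link v H))) * d"
      using kruskal_katona[OF uniform_link[OF unif]] d_pos by (intro mult_right_mono) simp_all
    finally show ?thesis .
  qed
  have "real k * real (card H) * ?c \<le> (real k - 1) * real (card (lower_shadow H)) * d"
    using shadow_ratio_from_links[OF finite_atLeastAtMost unif H_sub links] d_pos r(1) by simp
  moreover have "0 < card H" using fin assms(4) by (simp add: card_gt_0_iff)
  ultimately have "real k * ?c / ((real k - 1) * d)
      \<le> real (card (lower_shadow H)) / real (card H)"
    using d_pos r by (simp add: field_simps)
  moreover have "lower_shadow H = shadow n k H"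
    using shadow_eq_lower_shadow[OF sub] r(1) by simp
  moreover have "real k * ?c / ((real k - 1) * d)
      = real ((t + 2) choose (k - 1))
        / (real ((t + 2) choose k) - (real t + 2) / real k * (real ((t + 1) choose (k - 1)) - d))"
  proof -
    have absorb: "real i * real ((t + 2) choose i) = (real t + 2) * real ((t + 1) choose (i - 1))"
      if "0 < i" for i
    proof -
      have "i * ((t + 2) choose i) = (t + 2) * ((t + 1) choose (i - 1))"
        using Suc_times_binomial[of "i - 1" "t + 1"] that by (simp del: binomial_Suc_Suc)
      from arg_cong[OF this, of real] show ?thesis
        by (simp only: of_nat_add of_nat_mult of_nat_numeral)
    qed
    have "real ((t + 2) choose k) = (real t + 2) / real k * real ((t + 1) choose (k - 1))"
      using absorb[of k] r by (simp add: field_simps del: binomial_Suc_Suc)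
    then have denominator: "real ((t + 2) choose k)
        - (real t + 2) / real k * (real ((t + 1) choose (k - 1)) - d) = (real t + 2) / real k * d"
      by (simp add: right_diff_distrib)
    have "(real k - 1) * real ((t + 2) choose (k - 1)) = (real t + 2) * ?c"
      using absorb[of "k - 1"] r by (simp add: of_nat_diff numeral_2_eq_2 del: binomial_Suc_Suc)
    then have numerator: "real ((t + 2) choose (k - 1)) = (real t + 2) * ?c / (real k - 1)"
      using r by (simp add: field_simps)
    have "p * c / (q * d) = (u * c / q) / (u / p * d)"
      if "0 < p" "0 < q" "0 < u" for p q u c :: real
      using that d_pos by (simp add: field_simps)
    then show ?thesis
      unfolding denominator numerator using r by simp
  qed
  ultimately show ?thesis by simp
qed

end
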